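(* Every lattice path flag matroid polytope is a Bruhat interval polytope. That is, for every full lattice path flag matroid $\mathcal F=(M_0,M_1,\dots,M_n)$ on $[n]$ there are permutations $v\leq_B w$ in $S_n$ such that the flag matroid polytope $\Delta_{\mathcal F}$ equals the Bruhat interval polytope $P_{v,w}$.
   Context: $[n]=\{1,\dots,n\}$. For $A=\{a_1<\dots<a_k\}$, $B=\{b_1<\dots<b_k\}$ in $\binom{[n]}{k}$, $A\leq_G B$ (Gale order) iff $a_i\leq b_i$ for all $i$. For $U\leq_G L$ in $\binom{[n]}{k}$, the lattice path matroid (LPM) $M[U,L]$ is the matroid on $[n]$ with set of bases $\{B\in\binom{[n]}{k}: U\leq_G B\leq_G L\}$. For matroids $M,M'$ on $[n]$ with sets of bases $\mathcal B,\mathcal B'$, $M'\leq_Q M$ ($M'$ is a quotient of $M$) if for all $B\in\mathcal B$ and $p\in[n]\setminus B$ there is $B'\in\mathcal B'$ with $B'\subseteq B$ such that for all $q\in B'$: if $(B'\cup\{p\})\setminus\{q\}\in\mathcal B'$ then $(B\cup\{p\})\setminus\{q\}\in\mathcal B$. A (full) lattice path flag matroid (LPFM) on $[n]$ is a sequence $\mathcal F=(M_0,M_1,\dots,M_n)$ of distinct LPMs on $[n]$ with $M_i\leq_Q M_{i+1}$ for $0\leq i\leq n-1$ (so $M_i$ has rank $i$). A flag of bases of $\mathcal F$ is a chain $B_0\subseteq B_1\subseteq\dots\subseteq B_n$ with $B_i$ a basis of $M_i$. With $e_B=\sum_{i\in B}e_i\in\mathbb R^n$, the flag matroid polytope is $\Delta_{\mathcal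 F}=\operatorname{conv}\{e_{B_0}+\dots+e_{B_n} : (B_0,\dots,B_n)\text{ a flag of bases of }\mathcal F\}$. Strong Bruhat order $\leq_B$ on $S_n$: $v$ covers $u$ if $v=u\circ(i,j)$ for some $i<j$ with $u(i)<u(j)$ such that for all $i<k<j$ one has $u(k)<u(i)$ or $u(k)>u(j)$; $\leq_B$ is the reflexive and transitive closure. For $v\leq_B w$ in $S_n$, the Bruhat interval polytope is $P_{v,w}=\operatorname{conv}\{(z(1),\dots,z(n)) : v\leq_B z\leq_B w\}\subset\mathbb R^n$. *)

theory Defs
  imports
    "HOL-Analysis.Analysis"
    "HOL-Analysis.Finite_Function_Topology"
    "HOL-Combinatorics.Permutations"
begin

(* A matroid on {1..n} is represented by its set of bases, of type "nat set set". *)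

definition gale_le :: "nat set \<Rightarrow> nat set \<Rightarrow> bool" where
  "gale_le A B \<longleftrightarrow> list_all2 (\<le>) (sorted_list_of_set A) (sorted_list_of_set B)"

definition ksubsets :: "nat \<Rightarrow> nat \<Rightarrow> nat set set" where
  "ksubsets n k = {A. A \<subseteq> {1..n} \<and> card A = k}"

definition lpm_bases :: "nat \<Rightarrow> nat \<Rightarrow> nat set \<Rightarrow> nat set \<Rightarrow> nat set set" where
  "lpm_bases n k U L = {B \<in> ksubsets n k. gale_le U B \<and> gale_le B L}"

definition is_lpm :: "nat \<Rightarrow> nat set set \<Rightarrow> bool" where
  "is_lpm n M \<longleftrightarrow>
     (\<exists>k. \<exists>U \<in> ksubsets n k. \<exists>L \<in> ksubsets n k. gale_le U L \<and> M = lpm_bases n k U L)"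

(* "is_quotient n M' M" says that M' is a quotient of M. *)
definition is_quotient :: "nat \<Rightarrow> nat set set \<Rightarrow> nat set set \<Rightarrow> bool" where
  "is_quotient n M' M \<longleftrightarrow>
     (\<forall>B \<in> M. \<forall>p \<in> {1..n} - B. \<exists>B' \<in> M'. B' \<subseteq> B \<and>
        (\<forall>q \<in> B'. (B' \<union> {p}) - {q} \<in> M' \<longrightarrow> (B \<union> {p}) - {q} \<in> M))"

(* Only F 0, ..., F n are relevant.  That F i has rank i is not assumed: it follows from
   the n + 1 matroids being distinct and forming a chain of quotients. *)
definition is_lpfm :: "nat \<Rightarrow> (nat \<Rightarrow> nat set set) \<Rightarrow> bool" where
  "is_lpfm n F \<longleftrightarrow>
     (\<forall>i\<le>n. is_lpm n (F i)) \<and> inj_on F {0..n} \<and> (\<forall>i<n. is_quotient n (F i) (F (Suc i)))"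

definition is_flag_of_bases :: "nat \<Rightarrow> (nat \<Rightarrow> nat set set) \<Rightarrow> (nat \<Rightarrow> nat set) \<Rightarrow> bool" where
  "is_flag_of_bases n F B \<longleftrightarrow> (\<forall>i\<le>n. B i \<in> F i) \<and> (\<forall>i<n. B i \<subseteq> B (Suc i))"

(* To have the dimension n as an ordinary natural number, R^n is realised as the coordinate
   subspace of the finitely supported functions from nat to the reals spanned by the unit
   vectors e_1, ..., e_n, where e_i is "Poly_Mapping.single i 1".  The type carries the usual
   pointwise real vector space structure, and convex hulls of subsets of the coordinate
   subspace stay inside it. *)

definition incidence_vec :: "nat set \<Rightarrow> (nat \<Rightarrow>\<^sub>0 real)" where
  "incidence_vec B = (\<Sum>i\<in>B. Poly_Mapping.single i 1)"

definition flag_matroid_polytope :: "nat \<Rightarrow> (nat \<Rightarrow> nat set set) \<Rightarrow> (nat \<Rightarrow>\<^sub>0 real) set" where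
  "flag_matroid_polytope n F =
     convex hull {(\<Sum>i=0..n. incidence_vec (B i)) | B. is_flag_of_bases n F B}"

definition bruhat_cover :: "nat \<Rightarrow> (nat \<Rightarrow> nat) \<Rightarrow> (nat \<Rightarrow> nat) \<Rightarrow> bool" where
  "bruhat_cover n u v \<longleftrightarrow>
     (\<exists>i j. 1 \<le> i \<and> i < j \<and> j \<le> n \<and> u i < u j \<and>
        (\<forall>k. i < k \<and> k < j \<longrightarrow> u k < u i \<or> u k > u j) \<and>
        v = u \<circ> Transposition.transpose i j)"

(* The permutations of {1..n} are closed under bruhat_cover, so requiring u to be a
   permutation makes this a relation on the symmetric group. *)
definition bruhat_le :: "nat \<Rightarrow> (nat \<Rightarrow> nat) \<Rightarrow> (nat \<Rightarrow> nat) \<Rightarrow> bool" where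
  "bruhat_le n u v \<longleftrightarrow> u permutes {1..n} \<and> v permutes {1..n} \<and> (bruhat_cover n)\<^sup>*\<^sup>* u v"

definition perm_vec :: "nat \<Rightarrow> (nat \<Rightarrow> nat) \<Rightarrow> (nat \<Rightarrow>\<^sub>0 real)" where
  "perm_vec n z = (\<Sum>i=1..n. Poly_Mapping.single i (real (z i)))"

definition bruhat_interval_polytope ::
    "nat \<Rightarrow> (nat \<Rightarrow> nat) \<Rightarrow> (nat \<Rightarrow> nat) \<Rightarrow> (nat \<Rightarrow>\<^sub>0 real) set" where
  "bruhat_interval_polytope n v w =
     convex hull {perm_vec n z | z. bruhat_le n v z \<and> bruhat_le n z w}"

end

theory Submission
  imports Defs
begin

text \<open>
  The two polytopes coincide because they are convex hulls of the same points.

  A complete flag \<open>B\<^sub>0 \<subseteq> \<dots> \<subseteq> B\<^sub>n\<close> of subsets of \<open>{1..n}\<close> is the same thing as a permutation \<open>z\<close>: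
  let \<open>z x\<close> be the number of members of the flag that contain \<open>x\<close>, and recover the flag as
  \<open>B\<^sub>i = {x. n < z x + i}\<close>. Under this correspondence the sum of the incidence vectors of the flag
  is exactly the point \<open>(z(1), \<dots>, z(n))\<close>. It remains to see that flags of bases correspond to the
  elements of one Bruhat interval, for which two facts are combined.

  The first is about quotients. If \<open>M[U',L']\<close> is a quotient of \<open>M[U,L]\<close>, then \<open>U' \<subseteq> U\<close> and
  \<open>L' \<subseteq> L\<close> (\<open>quotient_upper_subset\<close>, \<open>quotient_lower_subset\<close>): the Gale-extremal bases are the
  greedy bases for the two linear orders, and greedy bases of a quotient are contained in those of
  the matroid. In a full flag of distinct lattice path matroids the ranks must therefore be
  \<open>0, \<dots>, n\<close>, and the upper paths \<open>U\<^sub>i\<close> and the lower paths \<open>L\<^sub>i\<close> are themselves complete flags,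
  that is, permutations \<open>w\<close> and \<open>v\<close>.

  The second is the counting criterion for the strong Bruhat order (\<open>bruhat_le_iff_dots\<close>).
  Counting elements of initial segments also describes the Gale order (\<open>gale_le_iff_card\<close>), and the
  two counts are literally the same: \<open>v \<le> z\<close> in Bruhat order iff every member of the flag of \<open>z\<close>
  is Gale-below the corresponding member of the flag of \<open>v\<close> (\<open>bruhat_le_iff_perm_flag_gale\<close>).
  The condition \<open>U\<^sub>i \<le> B\<^sub>i \<le> L\<^sub>i\<close> for all \<open>i\<close> thus says that \<open>z\<close> lies between \<open>v\<close> and \<open>w\<close>.
  The order is reversed, since large values of \<open>z\<close> enter the flag first, so \<open>v\<close> comes from the
  lower paths and \<open>w\<close> from the upper ones.
\<close>

section \<open>The Gale order by counting\<close>

lemma nth_sorted_list_of_set_le_iff: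
  fixes A :: "nat set"
  assumes "finite A" "i < card A"
  shows "sorted_list_of_set A ! i \<le> m \<longleftrightarrow> i < card (A \<inter> {..m})"
proof -
  define xs where "xs = sorted_list_of_set A"
  have xs: "sorted xs" "distinct xs" "set xs = A" "length xs = card A"
    using assms by (auto simp: xs_def)
  define J where "J = {j. j < length xs \<and> xs ! j \<le> m}"
  have "bij_betw ((!) xs) {..<length xs} A"
    using bij_betw_nth[OF xs(2)] xs(3) by blast
  then have inj: "inj_on ((!) xs) {..<length xs}" and im: "(!) xs ` {..<length xs} = A"
    by (auto simp: bij_betw_def)
  have "(!) xs ` J = A \<inter> {..m}"
    using im by (auto simp: J_def)
  moreover have "inj_on ((!) xs) J"
    using inj by (rule inj_on_subset) (auto simp: J_def)
  ultimately have card: "card (A \<inter> {..m}) = card J"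
    by (metis card_image)
  have fin: "finite J" by (simp add: J_def)
  have i: "i < length xs" using assms xs by simp
  have "i < card J" if "xs ! i \<le> m"
  proof -
    have "{..i} \<subseteq> J"
      using that i xs(1) by (auto simp: J_def) (meson order.trans sorted_nth_mono)
    from card_mono[OF fin this] show ?thesis by simp
  qed
  moreover have "card J \<le> i" if "\<not> xs ! i \<le> m"
  proof -
    have "J \<subseteq> {..<i}"
    proof
      fix j assume j: "j \<in> J"
      show "j \<in> {..<i}"
      proof (rule ccontr)
        assume "j \<notin> {..<i}"
        then have "xs ! i \<le> xs ! j" using j xs(1) by (auto simp: J_def intro: sorted_nth_mono)
        with j that show False by (simp add: J_def)
      qed
    qed
    from card_mono[OF _ this] show ?thesis by simp
  qed
  ultimately show ?thesis
    unfolding card xs_def[symmetric] by (meson not_le)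
qed

text \<open>
  The height of a lattice path after \<open>m\<close> steps is the number of elements at most \<open>m\<close>; one set is
  Gale-below another of the same size iff its path never runs under the other path. Counts, unlike
  sorted lists, behave well under exchanging one element.
\<close>

lemma gale_le_iff_card:
  assumes "finite A" "finite B"
  shows "gale_le A B \<longleftrightarrow>
    card A = card B \<and> (\<forall>m. card (B \<inter> {..m}) \<le> card (A \<inter> {..m}))"
proof (cases "card A = card B")
  case False
  then show ?thesis using assms by (auto simp: gale_le_def dest: list_all2_lengthD)
next
  case eq: True
  have gale: "gale_le A B \<longleftrightarrow>
      (\<forall>i<card A. sorted_list_of_set A ! i \<le> sorted_list_of_set B ! i)"
    using assms eq by (simp add: gale_le_def list_all2_conv_all_nth)
  show ?thesis
  proof
    assume G: "gale_le A B"
    have "card (B \<inter> {..m}) \<le> card (A \<inter> {..m})" for m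
    proof (rule ccontr)
      assume "\<not> ?thesis"
      then have less: "card (A \<inter> {..m}) < card (B \<inter> {..m})" by simp
      also have "\<dots> \<le> card B" using assms by (intro card_mono) auto
      finally have i: "card (A \<inter> {..m}) < card A" using eq by simp
      then have "sorted_list_of_set B ! card (A \<inter> {..m}) \<le> m"
        using nth_sorted_list_of_set_le_iff[OF assms(2)] less eq by simp
      moreover have "sorted_list_of_set A ! card (A \<inter> {..m}) \<le>
          sorted_list_of_set B ! card (A \<inter> {..m})"
        using G gale i by blast
      ultimately show False
        using nth_sorted_list_of_set_le_iff[OF assms(1) i, of m] by simp
    qed
    with eq show "card A = card B \<and> (\<forall>m. card (B \<inter> {..m}) \<le> card (A \<inter> {..m}))" by blast
  next
    assume R: "card A = card B \<and> (\<forall>m. card (B \<inter> {..m}) \<le> card (A \<inter> {..m}))"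
    show "gale_le A B"
      unfolding gale
    proof (intro allI impI)
      fix i assume i: "i < card A"
      have "i < card (B \<inter> {..sorted_list_of_set B ! i})"
        using nth_sorted_list_of_set_le_iff[OF assms(2)] i eq by (metis order_refl)
      then have "i < card (A \<inter> {..sorted_list_of_set B ! i})"
        using R less_le_trans by blast
      then show "sorted_list_of_set A ! i \<le> sorted_list_of_set B ! i"
        using nth_sorted_list_of_set_le_iff[OF assms(1) i] by blast
    qed
  qed
qed

lemma card_exchange_atMost:
  fixes B :: "nat set"
  assumes "finite B" "q \<in> B" "p \<notin> B"
  shows "card ((B \<union> {p} - {q}) \<inter> {..m}) + of_bool (q \<le> m) =
         card (B \<inter> {..m}) + of_bool (p \<le> m)"
proof -
  have "card ((B \<union> {p} - {q}) \<inter> {..m}) + of_bool (q \<le> m) = card ((B \<union> {p}) \<inter> {..m})"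
  proof (cases "q \<le> m")
    case True
    have "(B \<union> {p} - {q}) \<inter> {..m} = (B \<union> {p}) \<inter> {..m} - {q}" by auto
    then show ?thesis
      using card_Suc_Diff1[of "(B \<union> {p}) \<inter> {..m}" q] assms True by simp
  next
    case False
    then have "(B \<union> {p} - {q}) \<inter> {..m} = (B \<union> {p}) \<inter> {..m}" by auto
    with False show ?thesis by simp
  qed
  also have "\<dots> = card (B \<inter> {..m}) + of_bool (p \<le> m)"
    using assms by (cases "p \<le> m") (auto simp: Int_insert_left)
  finally show ?thesis .
qed

lemma card_exchange:
  assumes "finite B" "q \<in> B" "p \<notin> B"
  shows "card (B \<union> {p} - {q}) = card B"
  using assms by (simp add: card_Diff_singleton card_insert_if)

section \<open>Quotients of lattice path matroids\<close>

lemma finite_ksubset: "A \<in> ksubsets n k \<Longrightarrow> finite A"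
  by (auto simp: ksubsets_def intro: finite_subset)

lemma lpm_bases_iff_card:
  assumes "U \<in> ksubsets n k" "L \<in> ksubsets n k"
  shows "B \<in> lpm_bases n k U L \<longleftrightarrow> B \<in> ksubsets n k \<and>
    (\<forall>m. card (B \<inter> {..m}) \<le> card (U \<inter> {..m}) \<and> card (L \<inter> {..m}) \<le> card (B \<inter> {..m}))"
proof (cases "B \<in> ksubsets n k")
  case True
  then show ?thesis
    using assms finite_ksubset[OF True] finite_ksubset[OF assms(1)] finite_ksubset[OF assms(2)]
    by (auto simp: lpm_bases_def gale_le_iff_card ksubsets_def)
qed (simp add: lpm_bases_def)

text \<open>
  Exchanging \<open>q\<close> for \<open>p\<close> moves the path by one unit exactly between \<open>p\<close> and \<open>q\<close>, so only there does
  it need room: below \<open>U\<close> if \<open>p < q\<close>, above \<open>L\<close> if \<open>q < p\<close>.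
\<close>

lemma lpm_exchange_mem:
  assumes B: "B \<in> lpm_bases n k U L" and UL: "U \<in> ksubsets n k" "L \<in> ksubsets n k"
    and "q \<in> B" "p \<notin> B" "p \<in> {1..n}"
    and up: "\<And>m. p \<le> m \<Longrightarrow> m < q \<Longrightarrow> card (B \<inter> {..m}) < card (U \<inter> {..m})"
    and dn: "\<And>m. q \<le> m \<Longrightarrow> m < p \<Longrightarrow> card (L \<inter> {..m}) < card (B \<inter> {..m})"
  shows "B \<union> {p} - {q} \<in> lpm_bases n k U L"
proof -
  have Bk: "B \<in> ksubsets n k" and BU: "card (B \<inter> {..m}) \<le> card (U \<inter> {..m})"
    and LB: "card (L \<inter> {..m}) \<le> card (B \<inter> {..m})" for m
    using B by (auto simp: lpm_bases_iff_card[OF UL])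
  note fin = finite_ksubset[OF Bk]
  have "B \<union> {p} - {q} \<in> ksubsets n k"
    using Bk card_exchange[OF fin \<open>q \<in> B\<close> \<open>p \<notin> B\<close>] \<open>p \<in> {1..n}\<close> by (auto simp: ksubsets_def)
  moreover have "card ((B \<union> {p} - {q}) \<inter> {..m}) \<le> card (U \<inter> {..m}) \<and>
      card (L \<inter> {..m}) \<le> card ((B \<union> {p} - {q}) \<inter> {..m})" for m
    using card_exchange_atMost[OF fin \<open>q \<in> B\<close> \<open>p \<notin> B\<close>, of m] BU[of m] LB[of m] up[of m] dn[of m]
    by (cases "q \<le> m"; cases "p \<le> m") auto
  ultimately show ?thesis by (simp add: lpm_bases_iff_card[OF UL])
qed

text \<open>
  Suppose that some \<open>x \<in> U'\<close> is missing from \<open>U\<close>, and apply the quotient condition to the basis \<open>U\<close>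
  and the element \<open>x\<close>. The path of the resulting \<open>B' \<subseteq> U\<close> lies strictly below that of \<open>U'\<close> after
  \<open>x\<close>, so \<open>B'\<close> has room to trade its next element \<open>q > x\<close> for \<open>x\<close>. The quotient condition
  transfers this exchange to \<open>U\<close>, which produces a basis above the upper path.
\<close>

lemma quotient_upper_subset:
  assumes UL: "U \<in> ksubsets n k" "L \<in> ksubsets n k" "gale_le U L"
    and UL': "U' \<in> ksubsets n k'" "L' \<in> ksubsets n k'"
    and Q: "is_quotient n (lpm_bases n k' U' L') (lpm_bases n k U L)"
  shows "U' \<subseteq> U"
proof
  fix x assume x: "x \<in> U'"
  show "x \<in> U"
  proof (rule ccontr)
    assume nx: "x \<notin> U"
    have fU: "finite U" "finite U'" using UL UL' finite_ksubset by auto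
    have xn: "x \<in> {1..n}" using x UL' by (auto simp: ksubsets_def)
    have U: "U \<in> lpm_bases n k U L"
      using UL by (auto simp: lpm_bases_iff_card gale_le_iff_card finite_ksubset)
    then obtain B' where B': "B' \<in> lpm_bases n k' U' L'" "B' \<subseteq> U"
      and ex: "\<And>q. q \<in> B' \<Longrightarrow> B' \<union> {x} - {q} \<in> lpm_bases n k' U' L' \<Longrightarrow>
        U \<union> {x} - {q} \<in> lpm_bases n k U L"
      using Q xn nx unfolding is_quotient_def by (metis DiffI)
    have cB': "card B' = card U'" and BU: "card (B' \<inter> {..m}) \<le> card (U' \<inter> {..m})" for m
      using B'(1) UL' by (auto simp: lpm_bases_iff_card[OF UL'] ksubsets_def)
    have fB': "finite B'" using B'(2) fU finite_subset by blast
    have xB: "x \<notin> B'" using nx B' by auto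
    have stepU: "card (U' \<inter> {..x}) = Suc (card (U' \<inter> {..<x}))"
    proof -
      have "U' \<inter> {..x} = insert x (U' \<inter> {..<x})" using x by auto
      then show ?thesis using fU by simp
    qed
    have stepB: "card (B' \<inter> {..x}) < card (U' \<inter> {..x})"
    proof (cases x)
      case 0
      with xn show ?thesis by simp
    next
      case (Suc y)
      then have "B' \<inter> {..x} = B' \<inter> {..y}" using xB by (auto simp: le_Suc_eq)
      moreover have "{..<x} = {..y}" using Suc by auto
      ultimately show ?thesis using stepU BU[of y] by simp
    qed
    also have "\<dots> \<le> card U'" using fU by (intro card_mono) auto
    finally have "B' \<inter> {..x} \<noteq> B'" using cB' by auto
    then have ne: "B' \<inter> {x<..} \<noteq> {}"
      by (auto simp: Int_absorb2 subset_iff disjoint_iff not_less)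
    define q where "q = Min (B' \<inter> {x<..})"
    have q: "q \<in> B'" "x < q" using Min_in[OF _ ne] fB' by (auto simp: q_def)
    have gap: "y \<notin> B'" if "x < y" "y < q" for y
    proof
      assume "y \<in> B'"
      then have "q \<le> y" unfolding q_def using that fB' by (intro Min_le) auto
      with that show False by simp
    qed
    have "B' \<union> {x} - {q} \<in> lpm_bases n k' U' L'"
    proof (rule lpm_exchange_mem[OF B'(1) UL' q(1) xB xn])
      fix m assume m: "x \<le> m" "m < q"
      have "y \<le> m \<longleftrightarrow> y \<le> x" if "y \<in> B'" for y
        using that m gap[of y] by (cases "y \<le> x") auto
      then have "B' \<inter> {..m} = B' \<inter> {..x}" by auto
      moreover have "card (U' \<inter> {..x}) \<le> card (U' \<inter> {..m})"
        using fU m by (intro card_mono) auto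
      ultimately show "card (B' \<inter> {..m}) < card (U' \<inter> {..m})" using stepB by simp
    qed (use q in simp)
    then have "U \<union> {x} - {q} \<in> lpm_bases n k U L" using ex q by blast
    then have "card ((U \<union> {x} - {q}) \<inter> {..x}) \<le> card (U \<inter> {..x})"
      by (auto simp: lpm_bases_iff_card[OF UL(1,2)])
    moreover have "q \<in> U" using q B' by auto
    ultimately show False
      using card_exchange_atMost[OF fU(1) _ nx, of q x] q(2) by simp
  qed
qed

text \<open>
  The mirror image of the previous argument under reversing the order of \<open>{1..n}\<close>: now \<open>x \<in> L' - L\<close>
  is traded for the last element \<open>q < x\<close> of \<open>B'\<close>.
\<close>

lemma quotient_lower_subset:
  assumes UL: "U \<in> ksubsets n k" "L \<in> ksubsets n k" "gale_le U L"
    and UL': "U' \<in> ksubsets n k'" "L' \<in> ksubsets n k'"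
    and Q: "is_quotient n (lpm_bases n k' U' L') (lpm_bases n k U L)"
  shows "L' \<subseteq> L"
proof
  fix x assume x: "x \<in> L'"
  show "x \<in> L"
  proof (rule ccontr)
    assume nx: "x \<notin> L"
    have fL: "finite L" "finite L'" using UL UL' finite_ksubset by auto
    have xn: "x \<in> {1..n}" using x UL' by (auto simp: ksubsets_def)
    have L: "L \<in> lpm_bases n k U L"
      using UL by (auto simp: lpm_bases_iff_card gale_le_iff_card finite_ksubset)
    then obtain B' where B': "B' \<in> lpm_bases n k' U' L'" "B' \<subseteq> L"
      and ex: "\<And>q. q \<in> B' \<Longrightarrow> B' \<union> {x} - {q} \<in> lpm_bases n k' U' L' \<Longrightarrow>
        L \<union> {x} - {q} \<in> lpm_bases n k U L"
      using Q xn nx unfolding is_quotient_def by (metis DiffI)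
    have LB: "card (L' \<inter> {..m}) \<le> card (B' \<inter> {..m})" for m
      using B'(1) by (auto simp: lpm_bases_iff_card[OF UL'])
    have fB': "finite B'" using B'(2) fL finite_subset by blast
    have xB: "x \<notin> B'" using nx B' by auto
    have stepL: "card (L' \<inter> {..x}) = Suc (card (L' \<inter> {..<x}))"
    proof -
      have "L' \<inter> {..x} = insert x (L' \<inter> {..<x})" using x by auto
      then show ?thesis using fL by simp
    qed
    have Bx: "B' \<inter> {..x} = B' \<inter> {..<x}" using xB by (auto simp: le_less)
    have stepB: "card (L' \<inter> {..<x}) < card (B' \<inter> {..<x})"
      using LB[of x] stepL Bx by simp
    then have ne: "B' \<inter> {..<x} \<noteq> {}" by auto
    define q where "q = Max (B' \<inter> {..<x})"
    have q: "q \<in> B'" "q < x" using Max_in[OF _ ne] fB' by (auto simp: q_def)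
    have gap: "y \<notin> B'" if "q < y" "y < x" for y
    proof
      assume "y \<in> B'"
      then have "y \<le> q" unfolding q_def using that fB' by (intro Max_ge) auto
      with that show False by simp
    qed
    have "B' \<union> {x} - {q} \<in> lpm_bases n k' U' L'"
    proof (rule lpm_exchange_mem[OF B'(1) UL' q(1) xB xn])
      fix m assume m: "q \<le> m" "m < x"
      have "y \<le> m \<longleftrightarrow> y < x" if "y \<in> B'" for y
        using that m gap[of y] by (cases "q < y") auto
      then have "B' \<inter> {..m} = B' \<inter> {..<x}" by auto
      moreover have "card (L' \<inter> {..m}) \<le> card (L' \<inter> {..<x})"
        using fL m by (intro card_mono) auto
      ultimately show "card (L' \<inter> {..m}) < card (B' \<inter> {..m})" using stepB by simp
    qed (use q in simp)
    then have "L \<union> {x} - {q} \<in> lpm_bases n k U L" using ex q by blast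
    then have "card (L \<inter> {..q}) \<le> card ((L \<union> {x} - {q}) \<inter> {..q})"
      by (auto simp: lpm_bases_iff_card[OF UL(1,2)])
    moreover have "q \<in> L" using q B' by auto
    ultimately show False
      using card_exchange_atMost[OF fL(1) _ nx, of q q] q(2) by simp
  qed
qed

text \<open>
  By the two inclusions the rank cannot drop along the flag. If it stayed the same at some step,
  both pairs of boundary paths would agree and the two matroids would be equal; so the \<open>n + 1\<close> ranks
  increase strictly inside \<open>{0..n}\<close>.
\<close>

lemma lpfm_boundary_chains:
  assumes "is_lpfm n F"
  obtains U L where
    "\<And>i. i \<le> n \<Longrightarrow> U i \<in> ksubsets n i" "\<And>i. i \<le> n \<Longrightarrow> L i \<in> ksubsets n i"
    "\<And>i. i \<le> n \<Longrightarrow> gale_le (U i) (L i)" "\<And>i. i \<le> n \<Longrightarrow> F i = lpm_bases n i (U i) (L i)"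
    "\<And>i. i < n \<Longrightarrow> U i \<subseteq> U (Suc i)" "\<And>i. i < n \<Longrightarrow> L i \<subseteq> L (Suc i)"
proof -
  have "\<forall>i. \<exists>k U L. i \<le> n \<longrightarrow> U \<in> ksubsets n k \<and> L \<in> ksubsets n k \<and> gale_le U L \<and>
      F i = lpm_bases n k U L"
    using assms unfolding is_lpfm_def is_lpm_def by meson
  then obtain k U L where
    "\<forall>i. i \<le> n \<longrightarrow> U i \<in> ksubsets n (k i) \<and> L i \<in> ksubsets n (k i) \<and>
      gale_le (U i) (L i) \<and> F i = lpm_bases n (k i) (U i) (L i)"
    by metis
  then have UL: "U i \<in> ksubsets n (k i)" "L i \<in> ksubsets n (k i)" "gale_le (U i) (L i)"
    and F: "F i = lpm_bases n (k i) (U i) (L i)" if "i \<le> n" for i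
    using that by auto
  have sub: "U i \<subseteq> U (Suc i)" "L i \<subseteq> L (Suc i)" if i: "i < n" for i
  proof -
    have i': "i \<le> n" "Suc i \<le> n" using i by auto
    have "is_quotient n (F i) (F (Suc i))" using assms i by (simp add: is_lpfm_def)
    then have Q: "is_quotient n (lpm_bases n (k i) (U i) (L i))
        (lpm_bases n (k (Suc i)) (U (Suc i)) (L (Suc i)))"
      by (simp add: F i')
    show "U i \<subseteq> U (Suc i)" by (rule quotient_upper_subset[OF UL[OF i'(2)] UL(1,2)[OF i'(1)] Q])
    show "L i \<subseteq> L (Suc i)" by (rule quotient_lower_subset[OF UL[OF i'(2)] UL(1,2)[OF i'(1)] Q])
  qed
  have less: "k i < k (Suc i)" if i: "i < n" for i
  proof -
    have i': "i \<le> n" "Suc i \<le> n" using i by auto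
    have fin: "finite (U (Suc i))" "finite (L (Suc i))"
      using UL[OF i'(2)] finite_ksubset by auto
    have c: "card (U i) = k i" "card (L i) = k i" "card (U (Suc i)) = k (Suc i)"
        "card (L (Suc i)) = k (Suc i)"
      using UL[OF i'(1)] UL[OF i'(2)] by (auto simp: ksubsets_def)
    have "k i \<le> k (Suc i)" using card_mono[OF fin(1) sub(1)[OF i]] c by simp
    moreover have "k i \<noteq> k (Suc i)"
    proof
      assume eq: "k i = k (Suc i)"
      have "U i = U (Suc i)" "L i = L (Suc i)"
        using card_subset_eq[OF fin(1) sub(1)[OF i]] card_subset_eq[OF fin(2) sub(2)[OF i]] c eq
        by auto
      then have "F i = F (Suc i)" using F[OF i'(1)] F[OF i'(2)] eq by simp
      moreover have "inj_on F {0..n}" using assms by (simp add: is_lpfm_def)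
      ultimately show False using i inj_onD[of F "{0..n}" i "Suc i"] by simp
    qed
    ultimately show ?thesis by simp
  qed
  have le: "k i \<le> n" if "i \<le> n" for i
    using UL(1)[OF that] card_mono[of "{1..n}" "U i"] by (auto simp: ksubsets_def)
  have lo: "i \<le> k i" if "i \<le> n" for i
    using that
  proof (induction i)
    case (Suc i)
    then show ?case using less[of i] by simp
  qed simp
  have hi: "k (n - d) + d \<le> n" if "d \<le> n" for d
    using that
  proof (induction d)
    case 0
    then show ?case using le[of n] by simp
  next
    case (Suc d)
    then have "Suc (n - Suc d) = n - d" by simp
    then have "k (n - Suc d) < k (n - d)" using less[of "n - Suc d"] Suc.prems by simp
    with Suc show ?case by simp
  qed
  have k: "k i = i" if "i \<le> n" for i
    using lo[OF that] hi[of "n - i"] that by simp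
  show thesis
    by (rule that[of U L]) (use UL F sub k in auto)
qed

section \<open>The counting criterion for the strong Bruhat order\<close>

text \<open>
  The rank matrix of a permutation, often written \<open>z[m,j]\<close>, in which the dots of the permutation
  matrix are counted from one corner.
\<close>

definition dots :: "(nat \<Rightarrow> nat) \<Rightarrow> nat \<Rightarrow> nat \<Rightarrow> nat" where
  "dots z m j = card {a \<in> {1..m}. j \<le> z a}"

lemma dots_eq_sum: "dots z m j = (\<Sum>a\<in>{1..m}. of_bool (j \<le> z a))"
proof -
  have "{1..m} \<inter> {a. j \<le> z a} = {a \<in> {1..m}. j \<le> z a}" by auto
  then show ?thesis unfolding dots_def by (simp add: sum_of_bool_eq)
qed

lemma dots_comp_transpose:
  assumes "1 \<le> a" "a < b" "z a < z b"
  shows "dots (z \<circ> Transposition.transpose a b) m j =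
    dots z m j + of_bool (a \<le> m \<and> m < b \<and> z a < j \<and> j \<le> z b)"
proof -
  let ?t = "Transposition.transpose a b"
  consider "m < a" | "a \<le> m" "m < b" | "b \<le> m" by linarith
  then show ?thesis
  proof cases
    case 1
    then have "dots (z \<circ> ?t) m j = dots z m j"
      unfolding dots_eq_sum using assms by (intro sum.cong) (auto simp: transpose_def)
    with 1 show ?thesis by simp
  next
    case 2
    have split: "dots y m j = of_bool (j \<le> y a) + (\<Sum>x\<in>{1..m} - {a}. of_bool (j \<le> y x))" for y
      unfolding dots_eq_sum using 2 assms by (intro sum.remove) auto
    have rest: "(\<Sum>x\<in>{1..m} - {a}. of_bool (j \<le> (z \<circ> ?t) x)) =
        (\<Sum>x\<in>{1..m} - {a}. of_bool (j \<le> z x) :: nat)"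
      using 2 by (intro sum.cong) (auto simp: transpose_def)
    show ?thesis
      unfolding split[of "z \<circ> ?t"] split[of z] rest using 2 assms by (auto simp: of_bool_def)
  next
    case 3
    have "?t permutes {1..m}" using 3 assms by (intro permutes_swap_id) auto
    from sum.permute[OF this, of "\<lambda>x. of_bool (j \<le> z x)"]
    have "dots (z \<circ> ?t) m j = dots z m j" unfolding dots_eq_sum o_def by (rule sym)
    with 3 show ?thesis by simp
  qed
qed

lemma dots_mono_bruhat_cover:
  assumes "bruhat_cover n u v"
  shows "dots u m j \<le> dots v m j"
  using assms unfolding bruhat_cover_def by (auto simp: dots_comp_transpose)

lemma dots_split:
  assumes "j \<le> Suc c"
  shows "dots z m j = dots z m (Suc c) + card {x \<in> {1..m}. j \<le> z x \<and> z x \<le> c}"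
proof -
  have "{x \<in> {1..m}. j \<le> z x} = {x \<in> {1..m}. Suc c \<le> z x} \<union> {x \<in> {1..m}. j \<le> z x \<and> z x \<le> c}"
    using assms by auto
  then show ?thesis unfolding dots_def by (simp add: card_Un_disjoint disjoint_iff)
qed

text \<open>
  Let \<open>a\<close> be the first place where \<open>u\<close> and \<open>v\<close> differ; the counts at \<open>a\<close> force \<open>u a < v a\<close>. Swap
  \<open>a\<close> with the first later place \<open>b\<close> whose value lies in \<open>(u a, v a]\<close>. By the choice of \<open>b\<close> no value
  between them lies in that range, so this is a cover. It raises the counts of \<open>u\<close> by one in a
  rectangle, and there \<open>v\<close> has an additional point to spare: among the first \<open>m\<close> places, every value
  of \<open>u\<close> in \<open>[j, v a]\<close> occurs left of \<open>a\<close>, where \<open>v\<close> agrees with \<open>u\<close>, and \<open>v\<close> has the value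
  \<open>v a\<close> itself in addition.
\<close>

lemma bruhat_step_towards:
  assumes u: "u permutes {1..n}" and v: "v permutes {1..n}" and "u \<noteq> v"
    and le: "\<And>m j. m \<le> n \<Longrightarrow> dots u m j \<le> dots v m j"
  obtains a b where "1 \<le> a" "a < b" "b \<le> n" "u a < u b"
    "bruhat_cover n u (u \<circ> Transposition.transpose a b)"
    "\<And>m j. m \<le> n \<Longrightarrow> dots (u \<circ> Transposition.transpose a b) m j \<le> dots v m j"
proof -
  define a where "a = (LEAST x. u x \<noteq> v x)"
  have "\<exists>x. u x \<noteq> v x" using \<open>u \<noteq> v\<close> by auto
  then have a: "u a \<noteq> v a" unfolding a_def by (rule LeastI_ex)
  have agree: "u x = v x" if "x < a" for x
    using that not_less_Least unfolding a_def by blast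
  have an: "a \<in> {1..n}" using a u v by (metis permutes_not_in)
  have van: "v a \<in> {1..n}" using an permutes_in_image[OF v] by blast
  have fresh: "u x \<noteq> v a" if "x \<le> a" for x
    using that a agree[of x] permutes_inj[OF v] by (metis injD le_less)
  have ua: "u a < v a"
  proof (rule ccontr)
    assume "\<not> ?thesis"
    then have gt: "v a < u a" using a by simp
    have d: "dots z a (u a) = of_bool (u a \<le> z a) + (\<Sum>x\<in>{1..a} - {a}. of_bool (u a \<le> z x))" for z
      unfolding dots_eq_sum using an by (intro sum.remove) auto
    have "(\<Sum>x\<in>{1..a} - {a}. of_bool (u a \<le> u x)) = (\<Sum>x\<in>{1..a} - {a}. of_bool (u a \<le> v x) :: nat)"
      using agree by (intro sum.cong) auto
    then have "dots u a (u a) = Suc (dots v a (u a))" using d[of u] d[of v] gt by simp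
    with le[of a "u a"] an show False by simp
  qed
  obtain c where c: "u c = v a" using permutes_surj[OF u] by (metis surjD)
  then have "a < c" using fresh[of c] by (meson not_le)
  (* The place where u takes the value v a is a candidate, so a least such place exists. *)
  define b where "b = (LEAST x. a < x \<and> u a < u x \<and> u x \<le> v a)"
  have ex: "\<exists>x. a < x \<and> u a < u x \<and> u x \<le> v a" using c \<open>a < c\<close> ua by auto
  have b: "a < b" "u a < u b" "u b \<le> v a" using LeastI_ex[OF ex] by (auto simp: b_def)
  have between: "u x < u a \<or> v a < u x" if x: "a < x" "x < b" for x
  proof -
    have "\<not> (a < x \<and> u a < u x \<and> u x \<le> v a)" using x(2) not_less_Least unfolding b_def by blast
    moreover have "u x \<noteq> u a" using x(1) permutes_inj[OF u] by (metis injD less_irrefl)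
    ultimately show ?thesis using x(1) by linarith
  qed
  have bn: "b \<le> n"
  proof (rule ccontr)
    assume "\<not> b \<le> n"
    then have "u b = b" using u by (simp add: permutes_not_in)
    with b \<open>\<not> b \<le> n\<close> van show False by simp
  qed
  show thesis
  proof
    show "1 \<le> a" "a < b" "b \<le> n" "u a < u b" using an b bn by auto
    have "\<forall>k. a < k \<and> k < b \<longrightarrow> u k < u a \<or> u k > u b"
      using between b(3) by (meson le_less_trans)
    then show "bruhat_cover n u (u \<circ> Transposition.transpose a b)"
      unfolding bruhat_cover_def using an b bn by (metis atLeastAtMost_iff)
    fix m j :: nat assume m: "m \<le> n"
    show "dots (u \<circ> Transposition.transpose a b) m j \<le> dots v m j"
    proof (cases "a \<le> m \<and> m < b \<and> u a < j \<and> j \<le> u b")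
      case True
      have j: "j \<le> Suc (v a)" using True b by simp
      let ?S = "\<lambda>z. {x \<in> {1..m}. j \<le> z x \<and> z x \<le> v a}"
      have Su: "?S u \<subseteq> {..<a}"
      proof
        fix x assume x: "x \<in> ?S u"
        show "x \<in> {..<a}"
        proof (rule ccontr)
          assume "x \<notin> {..<a}"
          then have "x = a \<or> a < x \<and> x < b" using x True by auto
          then show False using x True between[of x] by auto
        qed
      qed
      have "a \<in> ?S v" using an True b by auto
      moreover have "?S u \<subseteq> ?S v"
      proof
        fix x assume x: "x \<in> ?S u"
        then have "u x = v x" using Su agree by blast
        with x show "x \<in> ?S v" by simp
      qed
      ultimately have "insert a (?S u) \<subseteq> ?S v" by blast
      then have "card (insert a (?S u)) \<le> card (?S v)" by (intro card_mono) auto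
      moreover have "a \<notin> ?S u" using Su by auto
      ultimately have "Suc (card (?S u)) \<le> card (?S v)" by simp
      (* Points above row v a are compared by the hypothesis, the others by the previous line. *)
      then have "Suc (dots u m j) \<le> dots v m j"
        using dots_split[OF j, of u m] dots_split[OF j, of v m] le[OF m, of "Suc (v a)"] by linarith
      then show ?thesis
        using True an b by (simp add: dots_comp_transpose)
    next
      case False
      have ab: "1 \<le> a" "a < b" "u a < u b" using an b by auto
      show ?thesis unfolding dots_comp_transpose[OF ab] using False le[OF m, of j] by auto
    qed
  qed
qed

lemma bruhat_le_if_dots_le:
  assumes "u permutes {1..n}" "v permutes {1..n}"
    and "\<And>m j. m \<le> n \<Longrightarrow> dots u m j \<le> dots v m j"
  shows "bruhat_le n u v"
proof -
  define T where "T z = (\<Sum>(m, j)\<in>{1..n} \<times> {1..n}. dots z m j)" for z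
  have T_mono: "T z \<le> T v" if "\<And>m j. m \<le> n \<Longrightarrow> dots z m j \<le> dots v m j" for z
    unfolding T_def using that by (intro sum_mono) auto
  (* Each step towards v raises the total count T, which is bounded by T v. *)
  have "(bruhat_cover n)\<^sup>*\<^sup>* u v"
    using assms(1,3)
  proof (induction "T v - T u" arbitrary: u rule: less_induct)
    case less
    show ?case
    proof (cases "u = v")
      case False
      from bruhat_step_towards[OF less.prems(1) assms(2) False less.prems(2)]
      obtain a b where ab: "1 \<le> a" "a < b" "b \<le> n" "u a < u b"
        and cover: "bruhat_cover n u (u \<circ> Transposition.transpose a b)"
        and le: "\<And>m j. m \<le> n \<Longrightarrow> dots (u \<circ> Transposition.transpose a b) m j \<le> dots v m j"
        by metis
      let ?u = "u \<circ> Transposition.transpose a b"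
      have perm: "?u permutes {1..n}"
        using ab less.prems(1) by (intro permutes_compose permutes_swap_id) auto
      have "b \<in> {1..n}" using ab by simp
      then have "u b \<in> {1..n}" using permutes_in_image[OF less.prems(1)] by blast
      then have "T u < T ?u"
        unfolding T_def using ab
        by (intro sum_strict_mono_ex1 ballI bexI[of _ "(a, u b)"])
           (auto simp: dots_comp_transpose)
      with T_mono[OF le] have "T v - T ?u < T v - T u" by simp
      from less.hyps[OF this perm le] cover show ?thesis
        by (meson converse_rtranclp_into_rtranclp)
    qed simp
  qed
  with assms show ?thesis by (simp add: bruhat_le_def)
qed

lemma bruhat_le_iff_dots:
  "bruhat_le n u v \<longleftrightarrow> u permutes {1..n} \<and> v permutes {1..n} \<and>
     (\<forall>m\<le>n. \<forall>j. dots u m j \<le> dots v m j)"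
proof
  assume "bruhat_le n u v"
  then have "u permutes {1..n}" "v permutes {1..n}" and star: "(bruhat_cover n)\<^sup>*\<^sup>* u v"
    by (auto simp: bruhat_le_def)
  moreover have "dots u m j \<le> dots v m j" for m j
    using star by (induction rule: rtranclp_induct) (auto intro: order_trans dots_mono_bruhat_cover)
  ultimately show "u permutes {1..n} \<and> v permutes {1..n} \<and>
     (\<forall>m\<le>n. \<forall>j. dots u m j \<le> dots v m j)" by blast
qed (use bruhat_le_if_dots_le in blast)

section \<open>Permutations as complete flags of subsets\<close>

definition perm_flag :: "nat \<Rightarrow> (nat \<Rightarrow> nat) \<Rightarrow> nat \<Rightarrow> nat set" where
  "perm_flag n z i = {x \<in> {1..n}. n < z x + i}"

lemma perm_flag_ksubset:
  assumes "z permutes {1..n}" "i \<le> n"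
  shows "perm_flag n z i \<in> ksubsets n i"
proof -
  have "z ` perm_flag n z i = {n - i<..n}"
  proof
    show "z ` perm_flag n z i \<subseteq> {n - i<..n}"
    proof
      fix y assume "y \<in> z ` perm_flag n z i"
      then obtain x where x: "x \<in> {1..n}" "n < z x + i" "y = z x" by (auto simp: perm_flag_def)
      then have "z x \<in> {1..n}" using permutes_in_image[OF assms(1)] by blast
      with x show "y \<in> {n - i<..n}" by auto
    qed
    show "{n - i<..n} \<subseteq> z ` perm_flag n z i"
    proof
      fix y assume y: "y \<in> {n - i<..n}"
      then have "y \<in> z ` {1..n}" using permutes_image[OF assms(1)] by auto
      with y show "y \<in> z ` perm_flag n z i" by (auto simp: perm_flag_def)
    qed
  qed
  moreover have "inj_on z (perm_flag n z i)"
    using permutes_inj[OF assms(1)] by (rule inj_on_subset) simp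
  ultimately have "card (perm_flag n z i) = card {n - i<..n}" by (metis card_image)
  with assms show ?thesis by (auto simp: ksubsets_def perm_flag_def)
qed

text \<open>
  A point of the graph of \<open>z\<close> weakly left of column \<open>m\<close> and weakly above row \<open>n + 1 - i\<close> is an
  element of the \<open>i\<close>-th member of the flag that is at most \<open>m\<close>. The counting criteria for the Bruhat
  order and for the Gale order are therefore the same inequalities, apart from degenerate rows and
  columns.
\<close>

lemma bruhat_le_iff_perm_flag_gale:
  assumes u: "u permutes {1..n}" and v: "v permutes {1..n}"
  shows "bruhat_le n u v \<longleftrightarrow> (\<forall>i\<le>n. gale_le (perm_flag n v i) (perm_flag n u i))"
proof -
  have gale: "gale_le (perm_flag n v i) (perm_flag n u i) \<longleftrightarrow>
      (\<forall>m. card (perm_flag n u i \<inter> {..m}) \<le> card (perm_flag n v i \<inter> {..m}))" if "i \<le> n" for i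
    using perm_flag_ksubset[OF u that] perm_flag_ksubset[OF v that]
    by (auto simp: gale_le_iff_card finite_ksubset) (auto simp: ksubsets_def)
  have dots: "dots z m (Suc n - i) = card (perm_flag n z i \<inter> {..m})" if "m \<le> n" "i \<le> n" for z m i
  proof -
    have "{a \<in> {1..m}. Suc n - i \<le> z a} = perm_flag n z i \<inter> {..m}"
      using that by (auto simp: perm_flag_def)
    then show ?thesis by (simp add: dots_def)
  qed
  show ?thesis
    unfolding bruhat_le_iff_dots
  proof (intro iffI allI impI conjI u v)
    fix i assume R: "u permutes {1..n} \<and> v permutes {1..n} \<and>
       (\<forall>m\<le>n. \<forall>j. dots u m j \<le> dots v m j)" and i: "i \<le> n"
    show "gale_le (perm_flag n v i) (perm_flag n u i)"
      unfolding gale[OF i]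
    proof
      fix m
      have "perm_flag n z i \<inter> {..m} = perm_flag n z i \<inter> {..min m n}" for z
        by (auto simp: perm_flag_def)
      then show "card (perm_flag n u i \<inter> {..m}) \<le> card (perm_flag n v i \<inter> {..m})"
        using R dots[of "min m n" i, OF _ i] by (metis min.cobounded2)
    qed
  next
    fix m j assume G: "\<forall>i\<le>n. gale_le (perm_flag n v i) (perm_flag n u i)" and m: "m \<le> n"
    consider "j = 0" | "1 \<le> j" "j \<le> Suc n" | "Suc n < j" by linarith
    then show "dots u m j \<le> dots v m j"
    proof cases
      case 1
      then show ?thesis by (simp add: dots_def)
    next
      case 2
      define i where "i = Suc n - j"
      have i: "i \<le> n" "j = Suc n - i" using 2 by (auto simp: i_def)
      then show ?thesis using G gale[OF i(1)] dots[OF m i(1)] by simp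
    next
      case 3
      have "u a \<le> n" if "a \<in> {1..m}" for a
        using that m permutes_in_image[OF u, of a] by auto
      then have empty: "{a \<in> {1..m}. j \<le> u a} = {}" using 3 by fastforce
      show ?thesis unfolding dots_def empty by simp
    qed
  qed
qed

lemma complete_flag_is_perm_flag:
  assumes B: "\<And>i. i \<le> n \<Longrightarrow> B i \<in> ksubsets n i" and sub: "\<And>i. i < n \<Longrightarrow> B i \<subseteq> B (Suc i)"
  shows "\<exists>z. z permutes {1..n} \<and> (\<forall>i\<le>n. perm_flag n z i = B i)"
proof -
  have mono: "B i \<subseteq> B j" if "i \<le> j" "j \<le> n" for i j
    using that
  proof (induction j rule: dec_induct)
    case (step j)
    then show ?case using sub[of j] by auto
  qed simp
  have B0: "B 0 = {}" using B[of 0] by (auto simp: ksubsets_def dest: finite_subset)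
  have Bn: "B n = {1..n}"
    using B[of n] card_subset_eq[of "{1..n}" "B n"] by (auto simp: ksubsets_def)
  (* r x is the rank at which x enters the flag; each rank admits exactly one new element. *)
  define r where "r x = (LEAST i. x \<in> B i)" for x
  have r: "x \<in> B (r x)" "r x \<le> n" "1 \<le> r x" if "x \<in> {1..n}" for x
  proof -
    show in_r: "x \<in> B (r x)" unfolding r_def by (rule LeastI[of _ n]) (use that Bn in simp)
    show "r x \<le> n" unfolding r_def by (rule Least_le) (use that Bn in simp)
    show "1 \<le> r x" using in_r B0 by (cases "r x") auto
  qed
  have mem: "x \<in> B i \<longleftrightarrow> r x \<le> i" if "x \<in> {1..n}" "i \<le> n" for x i
    using r[OF that(1)] mono[of "r x" i] that by (auto simp: r_def intro: Least_le)
  have inj_r: "x = y" if "x \<in> {1..n}" "y \<in> {1..n}" "r x = r y" for x y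
  proof -
    have "r x \<noteq> 0" using r(3)[OF that(1)] by simp
    then obtain i where i: "r x = Suc i" by (cases "r x") auto
    have Si: "Suc i \<le> n" "i \<le> n" using r(2)[OF that(1)] i by auto
    have c: "card (B i) = i" "card (B (Suc i)) = Suc i" "finite (B i)"
      using B[OF Si(1)] B[OF Si(2)] by (auto simp: ksubsets_def intro: finite_subset)
    have "card (B (Suc i) - B i) = 1"
      using card_Diff_subset[OF c(3) mono[of i "Suc i"]] Si c by simp
    then obtain w where "B (Suc i) - B i = {w}" by (auto simp: card_1_singleton_iff)
    moreover have "x \<in> B (Suc i) - B i" "y \<in> B (Suc i) - B i"
      using that i Si by (auto simp: mem)
    ultimately show ?thesis by auto
  qed
  define z where "z x = (if x \<in> {1..n} then Suc n - r x else x)" for x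
  have inj: "inj_on z {1..n}"
  proof (rule inj_onI)
    fix x y assume xy: "x \<in> {1..n}" "y \<in> {1..n}" "z x = z y"
    then have "r x = r y" using r(2)[OF xy(1)] r(2)[OF xy(2)] by (simp add: z_def)
    then show "x = y" using inj_r xy by blast
  qed
  have into: "z ` {1..n} \<subseteq> {1..n}"
  proof
    fix y assume "y \<in> z ` {1..n}"
    then obtain x where "x \<in> {1..n}" "y = Suc n - r x" by (auto simp: z_def)
    then show "y \<in> {1..n}" using r[of x] by auto
  qed
  have "z permutes {1..n}"
  proof (rule bij_imp_permutes)
    show "bij_betw z {1..n} {1..n}"
      using inj into by (simp add: bij_betw_def endo_inj_surj)
  qed (auto simp: z_def)
  moreover have "perm_flag n z i = B i" if i: "i \<le> n" for i
  proof -
    have "n < z x + i \<longleftrightarrow> x \<in> B i" if "x \<in> {1..n}" for x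
      using that i r[OF that] mem[OF that i] by (auto simp: z_def)
    then show ?thesis using B[OF i] by (auto simp: perm_flag_def ksubsets_def)
  qed
  ultimately show ?thesis by blast
qed

text \<open>
  The element \<open>x\<close> belongs to the members of the flag with index from \<open>n + 1 - z x\<close> to \<open>n\<close>, of which
  there are \<open>z x\<close>.
\<close>

lemma sum_incidence_vec_perm_flag:
  assumes z: "z permutes {1..n}"
  shows "(\<Sum>i=0..n. incidence_vec (perm_flag n z i)) = perm_vec n z"
proof -
  have "(\<Sum>i=0..n. incidence_vec (perm_flag n z i)) =
      (\<Sum>i=0..n. \<Sum>x\<in>{1..n}. if n < z x + i then Poly_Mapping.single x 1 else 0)"
    unfolding incidence_vec_def perm_flag_def
    by (intro sum.cong refl sum.inter_filter) auto
  also have "\<dots> = (\<Sum>x\<in>{1..n}. \<Sum>i=0..n. if n < z x + i then Poly_Mapping.single x 1 else 0)"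
    by (rule sum.swap)
  also have "\<dots> = (\<Sum>x\<in>{1..n}. Poly_Mapping.single x (real (z x)))"
  proof (rule sum.cong[OF refl])
    fix x assume "x \<in> {1..n}"
    then have zx: "1 \<le> z x" "z x \<le> n" using permutes_in_image[OF z, of x] by auto
    have const: "(\<Sum>i\<in>I. Poly_Mapping.single x (1::real)) = Poly_Mapping.single x (real (card I))"
      if "finite I" for I :: "nat set"
      using that by (induction I rule: finite_induct) (auto simp: single_add[symmetric] simp del: sum_constant)
    have "(\<Sum>i=0..n. if n < z x + i then Poly_Mapping.single x (1::real) else 0) =
        (\<Sum>i\<in>{i \<in> {0..n}. n < z x + i}. Poly_Mapping.single x 1)"
      by (rule sum.inter_filter[symmetric]) simp
    also have "{i \<in> {0..n}. n < z x + i} = {Suc n - z x..n}" using zx by auto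
    also have "(\<Sum>i\<in>{Suc n - z x..n}. Poly_Mapping.single x 1) = Poly_Mapping.single x (real (z x))"
      using const[of "{Suc n - z x..n}"] zx by simp
    finally show "(\<Sum>i=0..n. if n < z x + i then Poly_Mapping.single x (1::real) else 0) =
        Poly_Mapping.single x (real (z x))" .
  qed
  finally show ?thesis by (simp add: perm_vec_def)
qed

section \<open>Flags of bases form a Bruhat interval\<close>

theorem corollary33:
  fixes n :: nat and F :: "nat \<Rightarrow> nat set set"
  assumes "is_lpfm n F"
  shows "\<exists>v w. v permutes {1..n} \<and> w permutes {1..n} \<and> bruhat_le n v w \<and>
           flag_matroid_polytope n F = bruhat_interval_polytope n v w"
proof -
  obtain U L where U: "\<And>i. i \<le> n \<Longrightarrow> U i \<in> ksubsets n i"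
    and L: "\<And>i. i \<le> n \<Longrightarrow> L i \<in> ksubsets n i"
    and UL: "\<And>i. i \<le> n \<Longrightarrow> gale_le (U i) (L i)"
    and F: "\<And>i. i \<le> n \<Longrightarrow> F i = lpm_bases n i (U i) (L i)"
    and U_sub: "\<And>i. i < n \<Longrightarrow> U i \<subseteq> U (Suc i)"
    and L_sub: "\<And>i. i < n \<Longrightarrow> L i \<subseteq> L (Suc i)"
    by (rule lpfm_boundary_chains[OF assms]) blast
  obtain v where v: "v permutes {1..n}" "\<And>i. i \<le> n \<Longrightarrow> perm_flag n v i = L i"
    using complete_flag_is_perm_flag[of n L, OF L L_sub] by blast
  obtain w where w: "w permutes {1..n}" "\<And>i. i \<le> n \<Longrightarrow> perm_flag n w i = U i"
    using complete_flag_is_perm_flag[of n U, OF U U_sub] by blast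
  (* U i \<le> perm_flag n z i \<le> L i in the Gale order, read at all i at once. *)
  have interval: "bruhat_le n v z \<and> bruhat_le n z w \<longleftrightarrow> (\<forall>i\<le>n. perm_flag n z i \<in> F i)"
    if z: "z permutes {1..n}" for z
    using bruhat_le_iff_perm_flag_gale[OF v(1) z] bruhat_le_iff_perm_flag_gale[OF z w(1)]
      perm_flag_ksubset[OF z] v(2) w(2) F by (auto simp: lpm_bases_def)
  have "{(\<Sum>i=0..n. incidence_vec (B i)) | B. is_flag_of_bases n F B} =
      {perm_vec n z | z. bruhat_le n v z \<and> bruhat_le n z w}" (is "?L = ?R")
  proof
    show "?L \<subseteq> ?R"
    proof
      fix p assume "p \<in> ?L"
      then obtain B where B: "\<And>i. i \<le> n \<Longrightarrow> B i \<in> F i" "\<And>i. i < n \<Longrightarrow> B i \<subseteq> B (Suc i)"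
        and p: "p = (\<Sum>i=0..n. incidence_vec (B i))"
        by (auto simp: is_flag_of_bases_def)
      have Bk: "B i \<in> ksubsets n i" if "i \<le> n" for i
        using B(1)[OF that] F[OF that] by (simp add: lpm_bases_def)
      then obtain z where z: "z permutes {1..n}" "\<And>i. i \<le> n \<Longrightarrow> perm_flag n z i = B i"
        using complete_flag_is_perm_flag[of n B, OF Bk B(2)] by blast
      have "p = perm_vec n z"
        unfolding p sum_incidence_vec_perm_flag[OF z(1), symmetric] using z(2) by simp
      moreover have "bruhat_le n v z \<and> bruhat_le n z w"
        using interval[OF z(1)] z(2) B(1) by simp
      ultimately show "p \<in> ?R" by blast
    qed
    show "?R \<subseteq> ?L"
    proof
      fix p assume "p \<in> ?R"
      then obtain z where zb: "bruhat_le n v z \<and> bruhat_le n z w" and p: "p = perm_vec n z"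
        by blast
      then have z: "z permutes {1..n}" by (simp add: bruhat_le_def)
      have "is_flag_of_bases n F (perm_flag n z)"
        unfolding is_flag_of_bases_def using interval[OF z] zb by (auto simp: perm_flag_def)
      then show "p \<in> ?L" unfolding p sum_incidence_vec_perm_flag[OF z, symmetric] by blast
    qed
  qed
  then have "flag_matroid_polytope n F = bruhat_interval_polytope n v w"
    by (simp add: flag_matroid_polytope_def bruhat_interval_polytope_def)
  moreover have "bruhat_le n v w"
    unfolding bruhat_le_iff_perm_flag_gale[OF v(1) w(1)] using v(2) w(2) UL by simp
  ultimately show ?thesis using v(1) w(1) by blast
qed

end
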